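(* Let $N\ge 1$ be an integer. For every integer $n\ge 1$, $$ CC_{N,n}=\Pi(n)\sum_{k=1}^{n}(-L_N)^k\sum_{\substack{i_1,\dots,i_k\ge 1\\ r^{N+i_1}+\cdots+r^{N+i_k}=n+k r^N}}\frac{(-1)^{i_1+\cdots+i_k}}{L_{N+i_1}\cdots L_{N+i_k}}\,. $$
   Context: Let $r$ be a power of a prime, $T$ an indeterminate and $K=\mathbb F_r(T)$. For $i\ge 1$ put $[i]=T^{r^i}-T$, $D_i=[i][i-1]^r\cdots[1]^{r^{i-1}}$ and $L_i=[i][i-1]\cdots[1]$, with $D_0=L_0=1$. The Carlitz logarithm is the formal power series $\log_C(x)=\sum_{i=0}^\infty(-1)^i x^{r^i}/L_i\in K[[x]]$. For a non-negative integer $i$ with base-$r$ expansion $i=\sum_{j=0}^m c_j r^j$ ($0\le c_j<r$), the Carlitz factorial is $\Pi(i)=\prod_{j=0}^m D_j^{c_j}$. For $N\ge 1$, the truncated Cauchy-Carlitz numbers $CC_{N,n}\in K$ are defined by the formal power series identity $$ \frac{(-1)^N x^{r^N}/L_N}{\log_C(x)-\sum_{i=0}^{N-1}(-1)^i x^{r^i}/L_i}=\sum_{n=0}^\infty\frac{CC_{N,n}}{\Pi(n)}x^n . $$ *)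

theory Defs
  imports
    "HOL-Computational_Algebra.Computational_Algebra"
    "HOL-Library.Cardinality"
begin

text \<open>
  The finite field \<open>\<bbbF>\<^sub>r\<close> is a type \<open>'a\<close> of sort \<open>{field, finite}\<close>, so that \<open>r = CARD('a)\<close>, and
  \<open>K = \<bbbF>\<^sub>r(T)\<close> is \<open>'a poly fract\<close>.
\<close>

definition indet_T :: "'a::{field,finite} poly fract" where
  "indet_T = Fraction_Field.Fract [:0, 1:] 1"

definition carlitz_bracket :: "nat \<Rightarrow> 'a::{field,finite} poly fract" where
  "carlitz_bracket i = indet_T ^ (CARD('a) ^ i) - indet_T"

definition carlitz_D :: "nat \<Rightarrow> 'a::{field,finite} poly fract" where
  "carlitz_D i = (\<Prod>j=1..i. carlitz_bracket j ^ (CARD('a) ^ (i - j)))"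

definition carlitz_L :: "nat \<Rightarrow> 'a::{field,finite} poly fract" where
  "carlitz_L i = (\<Prod>j=1..i. carlitz_bracket j)"

text \<open>
  The coefficient of \<open>x ^ m\<close> is given by a sum with at most one summand, since \<open>r \<ge> 2\<close>; it is \<open>0\<close>
  if \<open>m\<close> is not a power of \<open>r\<close>. See \<open>carlitz_log_sums\<close> below for the form as an infinite series.
\<close>

definition carlitz_log :: "'a::{field,finite} poly fract fps" where
  "carlitz_log = Abs_fps (\<lambda>m. \<Sum>i | CARD('a) ^ i = m. (-1) ^ i / carlitz_L i)"

definition carlitz_log_term :: "nat \<Rightarrow> 'a::{field,finite} poly fract fps" where
  "carlitz_log_term i = fps_const ((-1) ^ i / carlitz_L i) * fps_X ^ (CARD('a) ^ i)"

text \<open>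
  The \<open>j\<close>-th digit of \<open>n\<close> in base \<open>r\<close> is \<open>n div r ^ j mod r\<close>; it vanishes for \<open>j > n\<close>, so that
  the product below covers all nonzero digits.
\<close>

definition carlitz_factorial :: "nat \<Rightarrow> 'a::{field,finite} poly fract" where
  "carlitz_factorial n = (\<Prod>j\<le>n. carlitz_D j ^ (n div CARD('a) ^ j mod CARD('a)))"

text \<open>
  Numerator and denominator both have order \<open>r ^ N\<close> at \<open>0\<close>, so that their quotient exists in the
  ring of formal power series; \<open>trunc_CC_generating\<close> below is the defining identity.
\<close>

definition trunc_CC :: "nat \<Rightarrow> nat \<Rightarrow> 'a::{field,finite} poly fract" where
  "trunc_CC N n = carlitz_factorial n *
     fps_nth (carlitz_log_term N / (carlitz_log - (\<Sum>i<N. carlitz_log_term i))) n"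


lemma CARD_field_ge_2: "CARD('a::{field,finite}) \<ge> 2"
proof -
  have "card {0, 1 :: 'a} \<le> CARD('a)"
    by (rule card_mono) auto
  thus ?thesis by simp
qed

lemma indet_T_power: "indet_T ^ k = Fraction_Field.Fract (monom (1 :: 'a::{field,finite}) k) 1"
proof (induction k)
  case 0
  show ?case by (simp add: One_fract_def)
next
  case (Suc k)
  thus ?case by (simp add: indet_T_def monom_Suc mult_monom)
qed

lemma carlitz_bracket_nonzero:
  assumes "i \<ge> 1"
  shows "(carlitz_bracket i :: 'a::{field,finite} poly fract) \<noteq> 0"
proof
  assume "(carlitz_bracket i :: 'a poly fract) = 0"
  hence "(indet_T :: 'a poly fract) ^ (CARD('a) ^ i) = indet_T ^ 1"
    by (simp add: carlitz_bracket_def)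
  hence "monom (1 :: 'a) (CARD('a) ^ i) = monom 1 1"
    unfolding indet_T_power by (simp add: eq_fract)
  hence "CARD('a) ^ i = 1"
    by (metis degree_monom_eq one_neq_zero)
  moreover have "CARD('a) ^ i > 1"
    using CARD_field_ge_2[where ?'a = 'a] assms by (intro one_less_power) auto
  ultimately show False by linarith
qed

lemma carlitz_L_nonzero: "(carlitz_L i :: 'a::{field,finite} poly fract) \<noteq> 0"
  by (auto simp: carlitz_L_def carlitz_bracket_nonzero)

lemma carlitz_D_nonzero: "(carlitz_D i :: 'a::{field,finite} poly fract) \<noteq> 0"
  by (auto simp: carlitz_D_def carlitz_bracket_nonzero)

lemma carlitz_factorial_nonzero: "(carlitz_factorial n :: 'a::{field,finite} poly fract) \<noteq> 0"
  by (auto simp: carlitz_factorial_def carlitz_D_nonzero)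

lemma fps_nth_carlitz_log_term:
  "fps_nth (carlitz_log_term i :: 'a::{field,finite} poly fract fps) m =
     (if m = CARD('a) ^ i then (-1) ^ i / carlitz_L i else 0)"
  by (simp add: carlitz_log_term_def fps_X_power_nth)

lemma CARD_power_eq_iff: "CARD('a::{field,finite}) ^ i = CARD('a) ^ j \<longleftrightarrow> i = j"
  using CARD_field_ge_2[where ?'a = 'a] by (intro power_inject_exp) auto

lemma fps_nth_carlitz_log:
  "fps_nth (carlitz_log :: 'a::{field,finite} poly fract fps) (CARD('a) ^ i) = (-1) ^ i / carlitz_L i"
  by (simp add: carlitz_log_def CARD_power_eq_iff)

lemma fps_nth_carlitz_log_eq_0:
  assumes "\<And>i. m \<noteq> CARD('a) ^ i"
  shows "fps_nth (carlitz_log :: 'a::{field,finite} poly fract fps) m = 0"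
proof -
  have "{i. CARD('a) ^ i = m} = {}" using assms by auto
  thus ?thesis by (simp add: carlitz_log_def)
qed

lemma fps_nth_sum_carlitz_log_term:
  "fps_nth (\<Sum>i<N. carlitz_log_term i :: 'a::{field,finite} poly fract fps) m =
     (if m < CARD('a) ^ N then fps_nth carlitz_log m else 0)"
proof (cases "\<exists>k. m = CARD('a) ^ k")
  case True
  then obtain k where k: "m = CARD('a) ^ k" by blast
  have "m < CARD('a) ^ N \<longleftrightarrow> k < N"
    unfolding k using CARD_field_ge_2[where ?'a = 'a] by (intro power_strict_increasing_iff) auto
  thus ?thesis
    by (simp add: k fps_sum_nth fps_nth_carlitz_log_term CARD_power_eq_iff fps_nth_carlitz_log)
next
  case False
  thus ?thesis
    by (simp add: fps_sum_nth fps_nth_carlitz_log_term fps_nth_carlitz_log_eq_0)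
qed

lemma carlitz_log_sums: "carlitz_log_term sums (carlitz_log :: 'a::{field,finite} poly fract fps)"
  unfolding sums_def
proof (rule metric_LIMSEQ_I)
  fix e :: real assume "e > 0"
  then obtain k :: nat where "(1 / 2) ^ k < e"
    using real_arch_pow_inv[of e "1 / 2"] by auto
  hence k: "inverse (2 ^ k) < e" by (simp add: power_one_over inverse_eq_divide)
  have "dist (\<Sum>i<n. carlitz_log_term i) (carlitz_log :: 'a poly fract fps) < e" if "n \<ge> k" for n
  proof -
    have "n < CARD('a) ^ n"
      using CARD_field_ge_2[where ?'a = 'a] by (intro power_gt_expt) auto
    hence "dist (\<Sum>i<n. carlitz_log_term i) (carlitz_log :: 'a poly fract fps) < inverse (2 ^ k)"
      using that by (auto simp: dist_less_eq_nth_equal fps_nth_sum_carlitz_log_term)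
    with k show ?thesis by simp
  qed
  thus "\<exists>no. \<forall>n\<ge>no. dist (\<Sum>i<n. carlitz_log_term i) (carlitz_log :: 'a poly fract fps) < e"
    by blast
qed

lemma trunc_CC_generating:
  "Abs_fps (\<lambda>n. trunc_CC N n / carlitz_factorial n) * (carlitz_log - (\<Sum>i<N. carlitz_log_term i))
     = (carlitz_log_term N :: 'a::{field,finite} poly fract fps)"
proof -
  let ?d = "carlitz_log - (\<Sum>i<N. carlitz_log_term i) :: 'a poly fract fps"
  have nz: "fps_nth ?d (CARD('a) ^ N) \<noteq> 0"
    by (simp add: fps_nth_sum_carlitz_log_term fps_nth_carlitz_log carlitz_L_nonzero)
  hence d: "?d \<noteq> 0" by auto
  have t: "fps_nth (carlitz_log_term N :: 'a poly fract fps) (CARD('a) ^ N) \<noteq> 0"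
    by (simp add: fps_nth_carlitz_log_term carlitz_L_nonzero)
  hence t0: "carlitz_log_term N \<noteq> (0 :: 'a poly fract fps)" by auto
  have "subdegree ?d = CARD('a) ^ N"
    using nz by (intro subdegreeI) (simp_all add: fps_nth_sum_carlitz_log_term)
  moreover have "subdegree (carlitz_log_term N :: 'a poly fract fps) = CARD('a) ^ N"
    using t by (intro subdegreeI) (simp_all add: fps_nth_carlitz_log_term)
  ultimately have "?d dvd carlitz_log_term N"
    using d t0 by (simp add: fps_dvd_iff)
  moreover have "Abs_fps (\<lambda>n. trunc_CC N n / carlitz_factorial n) = carlitz_log_term N / ?d"
    by (simp add: fps_eq_iff trunc_CC_def carlitz_factorial_nonzero)
  ultimately show ?thesis by simp
qed

lemma finite_exponent_lists:
  "finite {is. length is = k \<and> (\<forall>i\<in>set is. i \<ge> 1) \<and> (\<Sum>i\<leftarrow>is. CARD('a::{field,finite}) ^ (N + i)) = m}"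
proof (rule finite_subset)
  show "{is. length is = k \<and> (\<forall>i\<in>set is. i \<ge> 1) \<and> (\<Sum>i\<leftarrow>is. CARD('a) ^ (N + i)) = m}
          \<subseteq> {is. set is \<subseteq> {..m} \<and> length is = k}"
  proof safe
    fix "is" :: "nat list" and i assume i: "i \<in> set is"
    have "N + i < CARD('a) ^ (N + i)"
      using CARD_field_ge_2[where ?'a = 'a] by (intro power_gt_expt) auto
    also have "\<dots> \<le> (\<Sum>i\<leftarrow>is. CARD('a) ^ (N + i))"
      using i by (intro member_le_sum_list) auto
    finally show "i \<le> (\<Sum>i\<leftarrow>is. CARD('a) ^ (N + i))" by simp
  qed
qed (simp add: finite_lists_length_eq)

end

theory Submission
  imports Defs
begin

text \<open>
  Write \<open>q = r\<^sup>N\<close> and let \<open>g\<close> be the series of all \<open>-L\<^sub>N (-1)\<^sup>i x ^ (r ^ (N+i)) / L\<^bsub>N+i\<^esub>\<close> with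
  \<open>i \<ge> 1\<close>. The denominator of the generating function is the numerator times
  \<open>1 - g / x\<^sup>q\<close>, so that the generating function is the geometric series in \<open>g / x\<^sup>q\<close>. Its
  \<open>n\<close>-th coefficient is the sum of the coefficients of \<open>x ^ (n + k q)\<close> in \<open>g\<^sup>k\<close>, and \<open>g\<^sup>k\<close> is
  expanded over all lists of \<open>k\<close> exponents.
\<close>

text \<open>Multinomial expansion by induction on \<open>k\<close>: in the Cauchy product the extra
  factor supplies the head of the list and \<open>k\<close> further factors its tail. Finite fibres
  make all the sums genuine, since a sum over an infinite set defaults to 0.\<close>

lemma fps_nth_power_Abs_fps_sum:
  fixes f :: "'i \<Rightarrow> nat" and a :: "'i \<Rightarrow> 'b::comm_ring_1"
  assumes fin: "\<And>m. finite {i \<in> A. f i = m}"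
  shows "fps_nth (Abs_fps (\<lambda>m. \<Sum>i | i \<in> A \<and> f i = m. a i) ^ k) m =
    (\<Sum>is | length is = k \<and> set is \<subseteq> A \<and> (\<Sum>i\<leftarrow>is. f i) = m. \<Prod>i\<leftarrow>is. a i)"
proof (induction k arbitrary: m)
  case 0
  have "{is. is = [] \<and> set is \<subseteq> A \<and> (\<Sum>i\<leftarrow>is. f i) = m} = (if m = 0 then {[]} else {})"
    by auto
  thus ?case by simp
next
  case (Suc k)
  let ?S = "\<lambda>k m. {is. length is = k \<and> set is \<subseteq> A \<and> (\<Sum>i\<leftarrow>is. f i) = m}"
  have finS: "finite (?S k m)" for k m
  proof (rule finite_subset)
    \<comment> \<open>No entry of a list of weight \<open>m\<close> weighs more than
      \<open>m\<close>, so all entries come from finitely many finite fibres.\<close>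
    show "?S k m \<subseteq> {is. set is \<subseteq> (\<Union>j\<le>m. {i \<in> A. f i = j}) \<and> length is = k}"
      by (auto dest: subsetD intro!: member_le_sum_list)
  qed (use fin in \<open>auto intro!: finite_lists_length_eq\<close>)
  let ?I = "\<lambda>j. {i. i \<in> A \<and> f i = j}"
  have finI: "finite (?I j)" for j using fin[of j] by simp
  have "fps_nth (Abs_fps (\<lambda>m. \<Sum>i\<in>?I m. a i) ^ Suc k) m =
      (\<Sum>j=0..m. (\<Sum>i\<in>?I j. a i) * (\<Sum>is\<in>?S k (m - j). \<Prod>i\<leftarrow>is. a i))"
    by (simp add: fps_mult_nth Suc.IH)
  also have "\<dots> = (\<Sum>j=0..m. \<Sum>(i, is)\<in>?I j \<times> ?S k (m - j). a i * (\<Prod>i\<leftarrow>is. a i))"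
    by (simp add: sum_product sum.cartesian_product)
  also have "\<dots> = (\<Sum>(j, i, is)\<in>(SIGMA j:{0..m}. ?I j \<times> ?S k (m - j)). a i * (\<Prod>i\<leftarrow>is. a i))"
    using finS finI by (subst sum.Sigma) auto
  \<comment> \<open>Cons is the bijection; the degree \<open>j\<close> is recovered as the weight of
    the head.\<close>
  also have "\<dots> = (\<Sum>is\<in>?S (Suc k) m. \<Prod>i\<leftarrow>is. a i)"
    by (rule sum.reindex_bij_witness[where
          i = "\<lambda>is. (f (hd is), hd is, tl is)" and j = "\<lambda>(j, i, is). i # is"])
       (auto simp: length_Suc_conv)
  finally show ?case .
qed

text \<open>Cutting the geometric series after \<open>h ^ n\<close> leaves the remainder
  \<open>F * h ^ Suc n\<close>, whose order exceeds \<open>n\<close> because \<open>h\<close> has no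
  constant term.\<close>

lemma fps_nth_geometric:
  fixes F h :: "'b::field fps"
  assumes "F * (1 - h) = 1" and h0: "fps_nth h 0 = 0"
  shows "fps_nth F n = (\<Sum>k\<le>n. fps_nth (h ^ k) n)"
proof -
  have "F * (1 - h ^ Suc n) = F * (1 - h) * (\<Sum>k\<le>n. h ^ k)"
    using one_diff_power_eq[of h "Suc n"] by (simp only: lessThan_Suc_atMost mult.assoc)
  hence "F = (\<Sum>k\<le>n. h ^ k) + F * h ^ Suc n"
    unfolding assms(1) by (simp add: right_diff_distrib diff_eq_eq del: power_Suc)
  moreover have "fps_nth (F * h ^ Suc n) n = 0"
    unfolding fps_mult_nth using startsby_zero_power_prefix[OF h0, of "Suc n"]
    by (intro sum.neutral) auto
  ultimately have "fps_nth F n = fps_nth (\<Sum>k\<le>n. h ^ k) n"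
    by (metis add.right_neutral fps_add_nth)
  thus ?thesis by (simp add: fps_sum_nth)
qed

text \<open>This is the series \<open>g\<close> from above, its coefficients written as sums over
  fibres so that the multinomial expansion applies verbatim.\<close>

definition log_tail :: "nat \<Rightarrow> 'a::{field,finite} poly fract fps" where
  "log_tail N = Abs_fps (\<lambda>m. \<Sum>i | i \<in> {1..} \<and> CARD('a) ^ (N + i) = m.
     - carlitz_L N * ((-1) ^ i / carlitz_L (N + i)))"

lemma fps_nth_log_tail:
  "fps_nth (log_tail N :: 'a::{field,finite} poly fract fps) (CARD('a) ^ (N + i)) =
     (if i = 0 then 0 else - carlitz_L N * ((-1) ^ i / carlitz_L (N + i)))"
proof -
  have "{j. j \<in> {1..} \<and> CARD('a) ^ (N + j) = CARD('a) ^ (N + i)} = (if i = 0 then {} else {i})"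
    by (auto simp: CARD_power_eq_iff)
  thus ?thesis by (simp add: log_tail_def)
qed

lemma fps_nth_log_tail_eq_0:
  assumes "\<And>i. m \<noteq> CARD('a) ^ (N + i)"
  shows "fps_nth (log_tail N :: 'a::{field,finite} poly fract fps) m = 0"
proof -
  have "{i. i \<in> {1..} \<and> CARD('a) ^ (N + i) = m} = {}" using assms by auto
  thus ?thesis unfolding log_tail_def fps_nth_Abs_fps by (simp only: sum.empty)
qed

text \<open>The bound includes \<open>m = r ^ N\<close> because the exponents start at
  \<open>i = 1\<close>; hence the quotient by \<open>x ^ (r ^ N)\<close> is a power series and has
  no constant term.\<close>

lemma fps_nth_log_tail_le_eq_0:
  assumes "m \<le> CARD('a) ^ N"
  shows "fps_nth (log_tail N :: 'a::{field,finite} poly fract fps) m = 0"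
proof (cases "m = CARD('a) ^ N")
  case True
  thus ?thesis using fps_nth_log_tail[of N 0] by simp
next
  case False
  moreover have "CARD('a) ^ N \<le> CARD('a) ^ (N + i)" for i
    by (rule power_increasing) (auto simp: Suc_le_eq)
  ultimately have "m < CARD('a) ^ (N + i)" for i
    using assms by (metis le_less_trans le_neq_implies_less order.trans)
  thus ?thesis by (intro fps_nth_log_tail_eq_0) (metis less_irrefl)
qed

lemma carlitz_log_diff_eq:
  "carlitz_log - (\<Sum>i<N. carlitz_log_term i) =
     fps_const ((-1) ^ N / carlitz_L N) *
       (fps_X ^ (CARD('a) ^ N) - (log_tail N :: 'a::{field,finite} poly fract fps))"
proof (rule fps_ext)
  fix m
  let ?d = "carlitz_log - (\<Sum>i<N. carlitz_log_term i) :: 'a poly fract fps"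
  show "fps_nth ?d m = fps_nth (fps_const ((-1) ^ N / carlitz_L N) *
      (fps_X ^ (CARD('a) ^ N) - log_tail N)) m"
  proof (cases "\<exists>k. m = CARD('a) ^ k")
    case True
    then obtain k where k: "m = CARD('a) ^ k" by blast
    show ?thesis
    proof (cases "k < N")
      case True
      hence "m < CARD('a) ^ N"
        unfolding k using CARD_field_ge_2[where ?'a = 'a] by (intro power_strict_increasing) auto
      thus ?thesis
        by (simp add: fps_nth_sum_carlitz_log_term fps_nth_log_tail_le_eq_0 fps_X_power_nth)
    next
      case False
      then obtain i where i: "k = N + i" using le_Suc_ex by (metis not_less)
      have "\<not> m < CARD('a) ^ N"
        unfolding k i using CARD_field_ge_2[where ?'a = 'a]
        by (simp add: not_less power_increasing)
      \<comment> \<open>For \<open>i = 0\<close> the coefficient comes from the monomial alone, for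
        \<open>i > 0\<close> from \<open>log_tail\<close> alone; there \<open>L_N\<close> cancels
        and the signs multiply to \<open>(-1) ^ (N + i)\<close>.\<close>
      thus ?thesis
        unfolding k i fps_mult_left_const_nth fps_sub_nth fps_nth_sum_carlitz_log_term
          fps_nth_carlitz_log fps_X_power_nth fps_nth_log_tail CARD_power_eq_iff
        by (simp add: carlitz_L_nonzero power_add)
    qed
  next
    case False
    thus ?thesis
      by (auto simp: fps_nth_sum_carlitz_log_term fps_nth_carlitz_log_eq_0 fps_X_power_nth
          fps_nth_log_tail_eq_0)
  qed
qed

text \<open>The term \<open>k = 0\<close> is kept, so that \<open>n = 0\<close> is covered as
  well.\<close>

lemma trunc_CC_eq_sum_log_tail:
  "(trunc_CC N n :: 'a::{field,finite} poly fract) = carlitz_factorial n *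
     (\<Sum>k\<le>n. fps_nth (log_tail N ^ k) (n + k * CARD('a) ^ N))"
proof -
  define q where "q = CARD('a) ^ N"
  define c :: "'a poly fract" where "c = (-1) ^ N / carlitz_L N"
  define h :: "'a poly fract fps" where "h = fps_shift q (log_tail N)"
  define F :: "'a poly fract fps" where "F = Abs_fps (\<lambda>n. trunc_CC N n / carlitz_factorial n)"
  have c: "c \<noteq> 0" by (simp add: c_def carlitz_L_nonzero)
  have g: "log_tail N = fps_X ^ q * h"
    by (rule fps_ext) (simp add: h_def fps_X_power_mult_nth fps_nth_log_tail_le_eq_0 q_def)
  have "F * (fps_const c * (fps_X ^ q - fps_X ^ q * h)) = fps_const c * fps_X ^ q"
    using trunc_CC_generating[of N, where ?'a = 'a]
    unfolding carlitz_log_diff_eq g[symmetric]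
    unfolding carlitz_log_term_def F_def c_def q_def .
  hence "(fps_const c * fps_X ^ q) * (F * (1 - h)) = (fps_const c * fps_X ^ q) * 1"
    by (simp add: algebra_simps)
  hence "F * (1 - h) = 1"
    using c by (subst (asm) mult_left_cancel) auto
  moreover have "fps_nth h 0 = 0"
    by (simp add: h_def fps_nth_log_tail_le_eq_0 q_def)
  ultimately have "fps_nth F n = (\<Sum>k\<le>n. fps_nth (h ^ k) n)"
    by (rule fps_nth_geometric)
  also have "\<dots> = (\<Sum>k\<le>n. fps_nth (log_tail N ^ k) (n + k * q))"
  proof (rule sum.cong[OF refl])
    fix k
    \<comment> \<open>Degree \<open>n\<close> in \<open>h ^ k\<close> is degree
      \<open>n + k * q\<close> in \<open>log_tail N ^ k\<close>.\<close>
    have "log_tail N ^ k = fps_X ^ (k * q) * h ^ k"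
      by (simp only: g power_mult_distrib power_mult[symmetric] mult.commute[of k])
    thus "fps_nth (h ^ k) n = fps_nth (log_tail N ^ k) (n + k * q)"
      by (simp only: fps_X_power_mult_nth) simp
  qed
  finally have "fps_nth F n = (\<Sum>k\<le>n. fps_nth (log_tail N ^ k) (n + k * q))" .
  moreover have "trunc_CC N n = carlitz_factorial n * fps_nth F n"
    by (simp add: F_def carlitz_factorial_nonzero)
  ultimately show ?thesis
    by (simp only: q_def)
qed

lemma prod_list_sign_divide:
  fixes b :: "nat \<Rightarrow> 'b::field"
  shows "(\<Prod>i\<leftarrow>is. c * ((-1) ^ i / b i)) =
    c ^ length is * ((-1) ^ sum_list is / (\<Prod>i\<leftarrow>is. b i))"
  by (induction "is") (simp_all add: power_add)

lemma fps_nth_log_tail_power: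
  "fps_nth ((log_tail N :: 'a::{field,finite} poly fract fps) ^ k) m =
     (- carlitz_L N) ^ k *
       (\<Sum>is | length is = k \<and> (\<forall>i\<in>set is. i \<ge> 1) \<and> (\<Sum>i\<leftarrow>is. CARD('a) ^ (N + i)) = m.
          (-1) ^ sum_list is / (\<Prod>i\<leftarrow>is. carlitz_L (N + i)))"
proof -
  have fin: "finite {i \<in> {1..}. CARD('a) ^ (N + i) = m}" for m
  proof (rule finite_subset)
    \<comment> \<open>Powers outgrow their exponents, so each fibre lies below
      \<open>m\<close>.\<close>
    have "N + i < CARD('a) ^ (N + i)" for i
      using CARD_field_ge_2[where ?'a = 'a] by (intro power_gt_expt) auto
    thus "{i \<in> {1..}. CARD('a) ^ (N + i) = m} \<subseteq> {..m}"
      using add_leD2 less_imp_le by blast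
  qed simp
  show ?thesis
    unfolding log_tail_def fps_nth_power_Abs_fps_sum[OF fin] sum_distrib_left prod_list_sign_divide
    by (intro sum.cong) auto
qed

theorem theorem2:
  fixes N n :: nat
  assumes "N \<ge> 1" and "n \<ge> 1"
  shows "(trunc_CC N n :: 'a::{field,finite} poly fract) =
    carlitz_factorial n *
      (\<Sum>k=1..n. (- carlitz_L N) ^ k *
        (\<Sum>is | length is = k \<and> (\<forall>i\<in>set is. i \<ge> 1) \<and>
                 (\<Sum>i\<leftarrow>is. CARD('a) ^ (N + i)) = n + k * CARD('a) ^ N.
           (-1) ^ sum_list is / (\<Prod>i\<leftarrow>is. carlitz_L (N + i))))"
proof -
  let ?t = "\<lambda>k. fps_nth ((log_tail N :: 'a poly fract fps) ^ k) (n + k * CARD('a) ^ N)"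
  \<comment> \<open>The term \<open>k = 0\<close> is the coefficient of the series 1 at
    \<open>n\<close>, which vanishes as \<open>n \<ge> 1\<close>.\<close>
  have "(\<Sum>k\<le>n. ?t k) = (\<Sum>k=1..n. ?t k)"
    using assms(2) by (intro sum.mono_neutral_right) (auto simp: not_le)
  thus ?thesis
    unfolding trunc_CC_eq_sum_log_tail by (simp only: fps_nth_log_tail_power)
qed

end
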